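(* Let $X_N\subset\mathbb S^{d-1}$ be a spherical $t$-design with $N$ points, and write $Q_XF:=\frac1N\sum_{x\in X_N}F(x)$. Then for every even $\psi\in C([-1,1])$ and every $K\in\mathcal K^d_\circ$, $$\left|Q_X(\mathcal B_\psi K)-\int_{\mathbb S^{d-1}}\mathcal B_\psi K\,d\sigma\right|\le E_t(\psi)_\infty\,S(K).$$
   Context: Fix an integer $d\ge 2$. $\sigma$ is the normalized rotation-invariant Borel probability measure on the unit sphere $\mathbb S^{d-1}\subset\mathbb R^d$. $\mathcal K^d_\circ$ is the set of convex bodies (compact convex sets) in $\mathbb R^d$ with nonempty interior. For $K\in\mathcal K^d_\circ$, the surface area measure $S_K$ on $\mathbb S^{d-1}$ is the pushforward of $(d-1)$-dimensional Hausdorff measure on $\partial K$ under the ($\mathcal H^{d-1}$-a.e. defined) outer Gauss map, and $S(K):=S_K(\mathbb S^{d-1})$ is the surface area. For even $\psi\in C([-1,1])$ (real-valued), $$\mathcal B_\psi K(u):=\frac12\int_{\mathbb S^{d-1}}\psi(\langle u,v\rangle)\,dS_K(v),\qquad u\in\mathbb S^{d-1}.$$ A spherical $t$-design is a finite set $X_N\subset\mathbb S^{d-1}$ of $N$ points such that $\frac1N\sum_{x\in X_N}f(x)=\int f\,d\sigma$ for every spherical polynomial $f$ (restriction of a real polynomial to the sphere) of degree at most $t$. $E_t(\psi)_\infty:=\inf_q\|\psi-q\|_{L^\infty([-1,1])}$, the infimum over real univariate polynomials $q$ of degree at most $t$. *)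

theory Defs
  imports "HOL-Probability.Probability_Measure" "HOL-Probability.Essential_Supremum"
    "HOL-Computational_Algebra.Polynomial"
begin

section \<open>Hausdorff measure\<close>

text \<open>The factor is chosen so that the $k$-dimensional Hausdorff measure agrees with Lebesgue
  measure on $k$-dimensional subspaces of Euclidean space. The case distinction matters only for
  $k = 0$.\<close>

definition hausdorff_weight :: "nat \<Rightarrow> 'a::metric_space set \<Rightarrow> ennreal" where
  "hausdorff_weight k U =
     (if U = {} then 0 else ennreal (unit_ball_vol (real k) * (diameter U / 2) ^ k))"

definition hausdorff_pre :: "nat \<Rightarrow> real \<Rightarrow> 'a::metric_space set \<Rightarrow> ennreal" where
  "hausdorff_pre k \<delta> A =
     (INF U\<in>{U :: nat \<Rightarrow> 'a set. (\<forall>i. bounded (U i) \<and> diameter (U i) \<le> \<delta>) \<and> A \<subseteq> (\<Union>i. U i)}.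
        \<Sum>i. hausdorff_weight k (U i))"

definition hausdorff_outer :: "nat \<Rightarrow> 'a::metric_space set \<Rightarrow> ennreal" where
  "hausdorff_outer k A = (SUP \<delta>\<in>{0<..}. hausdorff_pre k \<delta> A)"

text \<open>\<open>measure_of\<close> yields the zero measure unless the set function is countably additive on the
  given sets; \<open>emeasure_hausdorff_measure\<close> below excludes that case.\<close>

definition hausdorff_measure :: "nat \<Rightarrow> 'a::metric_space measure" where
  "hausdorff_measure k = measure_of UNIV (sets borel) (hausdorff_outer k)"

lemma hausdorff_weight_empty [simp]: "hausdorff_weight k {} = 0"
  by (simp add: hausdorff_weight_def)

lemma hausdorff_pre_mono: "A \<subseteq> B \<Longrightarrow> hausdorff_pre k \<delta> A \<le> hausdorff_pre k \<delta> B"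
  unfolding hausdorff_pre_def by (rule INF_superset_mono) auto

lemma hausdorff_pre_antimono: "\<delta> \<le> \<epsilon> \<Longrightarrow> hausdorff_pre k \<epsilon> A \<le> hausdorff_pre k \<delta> A"
  unfolding hausdorff_pre_def by (rule INF_superset_mono) (auto intro: order_trans)

lemma hausdorff_outer_mono: "A \<subseteq> B \<Longrightarrow> hausdorff_outer k A \<le> hausdorff_outer k B"
  unfolding hausdorff_outer_def by (rule SUP_mono) (auto intro: hausdorff_pre_mono)

lemma hausdorff_pre_le:
  assumes "\<And>i. bounded (U i)" "\<And>i. diameter (U i) \<le> \<delta>" "A \<subseteq> (\<Union>i. U i)"
  shows "hausdorff_pre k \<delta> A \<le> (\<Sum>i. hausdorff_weight k (U i))"
  unfolding hausdorff_pre_def by (rule INF_lower) (use assms in auto)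

lemma hausdorff_outer_empty [simp]: "hausdorff_outer k {} = 0"
proof -
  have "hausdorff_pre k \<delta> ({} :: 'a set) = 0" if "\<delta> > 0" for \<delta>
    using hausdorff_pre_le[of "\<lambda>_. {} :: 'a set" \<delta> "{}" k] that by (simp add: diameter_def)
  then show ?thesis
    by (simp add: hausdorff_outer_def)
qed

lemma hausdorff_pre_countably_subadditive:
  fixes A :: "nat \<Rightarrow> 'a::metric_space set"
  shows "hausdorff_pre k \<delta> (\<Union>i. A i) \<le> (\<Sum>i. hausdorff_pre k \<delta> (A i))"
proof (rule ennreal_le_epsilon)
  fix e :: real
  assume fin: "(\<Sum>i. hausdorff_pre k \<delta> (A i)) < top" and e: "0 < e"
  have fin1: "hausdorff_pre k \<delta> (A i) < top" for i
    using fin by (metis ennreal_suminf_lessD)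
  have "\<exists>U. (\<forall>j. bounded (U j) \<and> diameter (U j) \<le> \<delta>) \<and> A i \<subseteq> (\<Union>j. U j) \<and>
          (\<Sum>j. hausdorff_weight k (U j)) \<le> hausdorff_pre k \<delta> (A i) + ennreal (e * (1/2) ^ Suc i)" for i
  proof -
    have "hausdorff_pre k \<delta> (A i) < hausdorff_pre k \<delta> (A i) + ennreal (e * (1/2) ^ Suc i)"
      using fin1[of i] e by (simp add: ennreal_add_left_cancel_less[of _ 0, simplified])
    then have "\<exists>U\<in>{U. (\<forall>j. bounded (U j) \<and> diameter (U j) \<le> \<delta>) \<and> A i \<subseteq> (\<Union>j. U j)}.
          (\<Sum>j. hausdorff_weight k (U j)) < hausdorff_pre k \<delta> (A i) + ennreal (e * (1/2) ^ Suc i)"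
      by (subst (asm) (1) hausdorff_pre_def) (simp add: INF_less_iff)
    then show ?thesis
      by (auto intro: less_imp_le)
  qed
  then obtain U where U: "\<And>i j. bounded (U i j)" "\<And>i j. diameter (U i j) \<le> \<delta>"
      "\<And>i. A i \<subseteq> (\<Union>j. U i j)"
      "\<And>i. (\<Sum>j. hausdorff_weight k (U i j)) \<le> hausdorff_pre k \<delta> (A i) + ennreal (e * (1/2) ^ Suc i)"
    by metis
  define V where "V n = (case prod_decode n of (i, j) \<Rightarrow> U i j)" for n
  have cov: "(\<Union>i. A i) \<subseteq> (\<Union>n. V n)"
  proof
    fix x assume "x \<in> (\<Union>i. A i)"
    then obtain i j where "x \<in> U i j"
      using U(3) by blast
    then have "x \<in> V (prod_encode (i, j))"
      by (simp add: V_def)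
    then show "x \<in> (\<Union>n. V n)"
      by blast
  qed
  have "hausdorff_pre k \<delta> (\<Union>i. A i) \<le> (\<Sum>n. hausdorff_weight k (V n))"
    by (rule hausdorff_pre_le[OF _ _ cov]) (auto simp: V_def U split: prod.split)
  also have "\<dots> = (\<Sum>n. (\<lambda>(i, j). hausdorff_weight k (U i j)) (prod_decode n))"
    by (simp add: V_def case_prod_beta)
  also have "\<dots> = (\<Sum>i. \<Sum>j. hausdorff_weight k (U i j))"
    using suminf_ennreal_2dimen[of "\<lambda>i. \<Sum>j. hausdorff_weight k (U i j)"
        "\<lambda>(i, j). hausdorff_weight k (U i j)"] by (simp add: comp_def)
  also have "\<dots> \<le> (\<Sum>i. hausdorff_pre k \<delta> (A i) + ennreal (e * (1/2) ^ Suc i))"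
    by (intro suminf_le U(4)) auto
  also have "\<dots> = (\<Sum>i. hausdorff_pre k \<delta> (A i)) + (\<Sum>i. ennreal (e * (1/2) ^ Suc i))"
    by (rule suminf_add[symmetric]) auto
  also have "(\<Sum>i. ennreal (e * (1/2) ^ Suc i)) = ennreal (e * 1)"
    by (rule suminf_ennreal_eq) (use e sums_mult[OF power_half_series, of e] in auto)
  finally show "hausdorff_pre k \<delta> (\<Union>i. A i) \<le> (\<Sum>i. hausdorff_pre k \<delta> (A i)) + ennreal e"
    by simp
qed

lemma hausdorff_outer_countably_subadditive:
  "hausdorff_outer k (\<Union>i::nat. A i) \<le> (\<Sum>i. hausdorff_outer k (A i))"
  unfolding hausdorff_outer_def[of k "\<Union>i. A i"]
proof (rule SUP_least)
  fix \<delta> :: real assume "\<delta> \<in> {0<..}"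
  then have "hausdorff_pre k \<delta> (A i) \<le> hausdorff_outer k (A i)" for i
    unfolding hausdorff_outer_def by (rule SUP_upper)
  then have "(\<Sum>i. hausdorff_pre k \<delta> (A i)) \<le> (\<Sum>i. hausdorff_outer k (A i))"
    by (intro suminf_le) auto
  then show "hausdorff_pre k \<delta> (\<Union>i. A i) \<le> (\<Sum>i. hausdorff_outer k (A i))"
    using hausdorff_pre_countably_subadditive order_trans by blast
qed

lemma outer_measure_space_hausdorff: "outer_measure_space (Pow UNIV) (hausdorff_outer k)"
  unfolding outer_measure_space_def positive_def increasing_def countably_subadditive_def
  by (auto intro: hausdorff_outer_mono hausdorff_outer_countably_subadditive)

lemma hausdorff_outer_Un_le:
  "hausdorff_outer k (A \<union> B) \<le> hausdorff_outer k A + hausdorff_outer k B"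
proof -
  interpret sigma_algebra UNIV "Pow UNIV :: 'a set set"
    by (rule sigma_algebra_Pow)
  have "subadditive (Pow UNIV) (hausdorff_outer k :: 'a set \<Rightarrow> ennreal)"
    using outer_measure_space_hausdorff countably_subadditive_subadditive
    by (auto simp: outer_measure_space_def)
  then have disj: "hausdorff_outer k (A \<union> (B - A)) \<le> hausdorff_outer k A + hausdorff_outer k (B - A)"
    by (rule subadditiveD) auto
  also have "\<dots> \<le> hausdorff_outer k A + hausdorff_outer k B"
    by (intro add_left_mono hausdorff_outer_mono) auto
  finally show ?thesis
    by simp
qed

lemma hausdorff_outer_separated:
  fixes A B :: "'a::metric_space set"
  assumes r: "r > 0" and sep: "\<And>a b. a \<in> A \<Longrightarrow> b \<in> B \<Longrightarrow> r \<le> dist a b"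
  shows "hausdorff_outer k A + hausdorff_outer k B \<le> hausdorff_outer k (A \<union> B)"
proof -
  have pre: "hausdorff_pre k \<delta> A + hausdorff_pre k \<delta> B \<le> hausdorff_pre k \<delta> (A \<union> B)"
    if "0 < \<delta>" "\<delta> < r" for \<delta>
    unfolding hausdorff_pre_def[of k \<delta> "A \<union> B"]
  proof (rule INF_greatest)
    fix U assume "U \<in> {U :: nat \<Rightarrow> 'a set. (\<forall>i. bounded (U i) \<and> diameter (U i) \<le> \<delta>) \<and> A \<union> B \<subseteq> (\<Union>i. U i)}"
    then have U: "\<And>i. bounded (U i)" "\<And>i. diameter (U i) \<le> \<delta>" "A \<union> B \<subseteq> (\<Union>i. U i)"
      by auto
    have empty: "diameter ({} :: 'a set) \<le> \<delta>"
      using \<open>0 < \<delta>\<close> by (simp add: diameter_def)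
    define V where "V i = (if U i \<inter> A \<noteq> {} then U i else {})" for i
    define W where "W i = (if U i \<inter> A \<noteq> {} then {} else U i)" for i
    have V: "hausdorff_pre k \<delta> A \<le> (\<Sum>i. hausdorff_weight k (V i))"
    proof (rule hausdorff_pre_le)
      show "A \<subseteq> (\<Union>i. V i)"
        using U(3) by (fastforce simp: V_def)
    qed (use U empty in \<open>auto simp: V_def\<close>)
    have W: "hausdorff_pre k \<delta> B \<le> (\<Sum>i. hausdorff_weight k (W i))"
    proof (rule hausdorff_pre_le)
      show "B \<subseteq> (\<Union>i. W i)"
      proof
        fix b assume b: "b \<in> B"
        then obtain i where i: "b \<in> U i"
          using U(3) by blast
        have "U i \<inter> A = {}"
        proof (rule ccontr)
          assume "U i \<inter> A \<noteq> {}"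
          then obtain a where a: "a \<in> U i" "a \<in> A"
            by blast
          have "r \<le> dist a b"
            using a b sep by blast
          also have "dist a b \<le> diameter (U i)"
            using U(1) a i by (simp add: diameter_bounded_bound)
          finally show False
            using U(2)[of i] \<open>\<delta> < r\<close> by simp
        qed
        then show "b \<in> (\<Union>i. W i)"
          using i by (auto simp: W_def)
      qed
    qed (use U empty in \<open>auto simp: W_def\<close>)
    have "(\<Sum>i. hausdorff_weight k (V i)) + (\<Sum>i. hausdorff_weight k (W i))
        = (\<Sum>i. hausdorff_weight k (V i) + hausdorff_weight k (W i))"
      by (rule suminf_add) auto
    also have "\<dots> = (\<Sum>i. hausdorff_weight k (U i))"
      by (rule suminf_cong) (auto simp: V_def W_def)
    finally show "hausdorff_pre k \<delta> A + hausdorff_pre k \<delta> B \<le> (\<Sum>i. hausdorff_weight k (U i))"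
      using add_mono[OF V W] by simp
  qed
  have le: "hausdorff_pre k \<delta> A + hausdorff_pre k \<epsilon> B \<le> hausdorff_outer k (A \<union> B)"
    if "\<delta> > 0" "\<epsilon> > 0" for \<delta> \<epsilon>
  proof -
    define m where "m = min (min \<delta> \<epsilon>) (r / 2)"
    have m: "0 < m" "m < r" "m \<le> \<delta>" "m \<le> \<epsilon>"
      using that r by (auto simp: m_def)
    have "hausdorff_pre k \<delta> A + hausdorff_pre k \<epsilon> B \<le> hausdorff_pre k m A + hausdorff_pre k m B"
      using m by (intro add_mono hausdorff_pre_antimono)
    also have "\<dots> \<le> hausdorff_pre k m (A \<union> B)"
      by (rule pre) (use m in auto)
    also have "\<dots> \<le> hausdorff_outer k (A \<union> B)"
      unfolding hausdorff_outer_def by (rule SUP_upper) (use m in auto)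
    finally show ?thesis .
  qed
  have "hausdorff_outer k A + hausdorff_outer k B
      = (SUP \<delta>\<in>{0<..}. hausdorff_pre k \<delta> A + hausdorff_outer k B)"
    unfolding hausdorff_outer_def[of k A] by (rule ennreal_SUP_add_left[symmetric]) auto
  also have "\<dots> \<le> hausdorff_outer k (A \<union> B)"
  proof (rule SUP_least)
    fix \<delta> :: real assume \<delta>: "\<delta> \<in> {0<..}"
    have "hausdorff_pre k \<delta> A + hausdorff_outer k B
        = (SUP \<epsilon>\<in>{0<..}. hausdorff_pre k \<delta> A + hausdorff_pre k \<epsilon> B)"
      unfolding hausdorff_outer_def[of k B] by (rule ennreal_SUP_add_right) auto
    also have "\<dots> \<le> hausdorff_outer k (A \<union> B)"
      by (rule SUP_least) (use \<delta> le in auto)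
    finally show "hausdorff_pre k \<delta> A + hausdorff_outer k B \<le> hausdorff_outer k (A \<union> B)" .
  qed
  finally show ?thesis .
qed

lemma hausdorff_outer_closed:
  fixes A C :: "'a::metric_space set"
  assumes C: "closed C"
  shows "hausdorff_outer k (A \<inter> C) + hausdorff_outer k (A - C) \<le> hausdorff_outer k A"
proof (cases "C = {} \<or> hausdorff_outer k A = top")
  case True
  then show ?thesis by auto
next
  case False
  then have ne: "C \<noteq> {}" and fin: "hausdorff_outer k A < top"
    by (auto simp: less_top)
  define B where "B n = {x \<in> A. 1 / real (Suc n) \<le> infdist x C}" for n
  define R where "R n = B (Suc n) - B n" for n
  have R_le: "(\<Sum>i<N. hausdorff_outer k (R (2 * i + c))) \<le> hausdorff_outer k (\<Union>i<N. R (2 * i + c))"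
    for c N
  proof (induction N)
    case 0
    then show ?case by simp
  next
    case (Suc N)
    show ?case
    proof (cases "N = 0")
      case True
      then show ?thesis by (simp add: lessThan_Suc)
    next
      case False
      define s where "s = 1 / real (2 * N + c) - 1 / real (2 * N + c + 1)"
      have "s > 0"
        unfolding s_def using False by (simp add: frac_less2)
      moreover have "s \<le> dist a b" if a: "a \<in> (\<Union>i<N. R (2 * i + c))" and b: "b \<in> R (2 * N + c)" for a b
      proof -
        obtain i where i: "i < N" "a \<in> R (2 * i + c)"
          using a by blast
        have "1 / real (2 * N + c) \<le> 1 / real (Suc (Suc (2 * i + c)))"
          using i by (intro divide_left_mono) auto
        also have "\<dots> \<le> infdist a C"
          using i by (auto simp: R_def B_def)
        finally have 1: "1 / real (2 * N + c) \<le> infdist a C" .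
        have 2: "infdist b C < 1 / real (2 * N + c + 1)"
          using b by (auto simp: R_def B_def)
        have "infdist a C \<le> infdist b C + dist a b"
          by (rule infdist_triangle)
        with 1 2 show ?thesis
          by (simp add: s_def)
      qed
      ultimately have "hausdorff_outer k (\<Union>i<N. R (2 * i + c)) + hausdorff_outer k (R (2 * N + c))
          \<le> hausdorff_outer k ((\<Union>i<N. R (2 * i + c)) \<union> R (2 * N + c))"
        by (rule hausdorff_outer_separated)
      then show ?thesis
        using order_trans[OF add_right_mono[OF Suc.IH, of "hausdorff_outer k (R (2 * N + c))"]]
        by (simp add: lessThan_Suc Un_commute add.commute)
    qed
  qed
  have sum_le: "(\<Sum>i. hausdorff_outer k (R (2 * i + c))) \<le> hausdorff_outer k A" for c
  proof (rule suminf_le_const)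
    fix N
    show "(\<Sum>i<N. hausdorff_outer k (R (2 * i + c))) \<le> hausdorff_outer k A"
      by (rule order_trans[OF R_le hausdorff_outer_mono]) (auto simp: R_def B_def)
  qed auto
  have "(\<Sum>n. hausdorff_outer k (R n)) \<le> hausdorff_outer k A + hausdorff_outer k A"
  proof (rule suminf_le_const)
    fix N
    have split: "(\<Sum>n<2 * M. f n) = (\<Sum>i<M. f (2 * i + 0)) + (\<Sum>i<M. f (2 * i + 1))"
      for f :: "nat \<Rightarrow> ennreal" and M
      by (induction M) (auto simp: algebra_simps)
    have "(\<Sum>n<N. hausdorff_outer k (R n)) \<le> (\<Sum>n<2 * N. hausdorff_outer k (R n))"
      by (rule sum_mono2) auto
    also have "\<dots> \<le> (\<Sum>i. hausdorff_outer k (R (2 * i + 0))) + (\<Sum>i. hausdorff_outer k (R (2 * i + 1)))"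
      unfolding split by (intro add_mono sum_le_suminf) auto
    also have "\<dots> \<le> hausdorff_outer k A + hausdorff_outer k A"
      by (intro add_mono sum_le)
    finally show "(\<Sum>n<N. hausdorff_outer k (R n)) \<le> hausdorff_outer k A + hausdorff_outer k A" .
  qed auto
  then have "(\<Sum>n. hausdorff_outer k (R n)) \<noteq> top"
    using fin by (auto simp: top_unique ennreal_add_eq_top)
  then have tail: "(\<lambda>n. \<Sum>m. hausdorff_outer k (R (m + n))) \<longlonglongrightarrow> 0"
  proof -
    let ?f = "\<lambda>n. hausdorff_outer k (R n)"
    assume fin: "suminf ?f \<noteq> top"
    have part: "sum ?f {..<n} \<noteq> top" for n
      using neq_top_trans[OF fin sum_le_suminf[of ?f "{..<n}"]] by simp
    have "suminf ?f - sum ?f {..<n} = (\<Sum>m. ?f (m + n))" for n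
      using suminf_offset[of ?f n] part[of n] by (simp add: ennreal_add_diff_cancel_left)
    moreover have "(\<lambda>n. suminf ?f - sum ?f {..<n}) \<longlonglongrightarrow> suminf ?f - suminf ?f"
      by (intro tendsto_diff_ennreal_general tendsto_const summable_LIMSEQ) (use fin in auto)
    ultimately show "(\<lambda>n. \<Sum>m. ?f (m + n)) \<longlonglongrightarrow> 0"
      using fin by (simp add: ennreal_minus_cancel_iff diff_eq_0_iff_ennreal less_top)
  qed
  have AC: "A - C \<subseteq> B n \<union> (\<Union>m. R (m + n))" for n
  proof
    fix x assume x: "x \<in> A - C"
    then have "infdist x C > 0"
      using C ne by (metis DiffD2 in_closed_iff_infdist_zero infdist_nonneg order_less_le)
    then obtain N where "1 / real (Suc N) \<le> infdist x C"
      by (metis inverse_eq_divide less_imp_le nat_approx_posE)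
    then have ex: "x \<in> B N"
      using x by (auto simp: B_def)
    define L where "L = (LEAST N. x \<in> B N)"
    have L: "x \<in> B L" "\<And>i. i < L \<Longrightarrow> x \<notin> B i"
      using ex by (auto simp: L_def intro: LeastI dest: not_less_Least)
    have Bmono: "B i \<subseteq> B j" if "i \<le> j" for i j
    proof -
      have "1 / real (Suc j) \<le> 1 / real (Suc i)"
        using that by (intro divide_left_mono) auto
      then show ?thesis
        by (auto simp: B_def)
    qed
    show "x \<in> B n \<union> (\<Union>m. R (m + n))"
    proof (cases "L \<le> n")
      case True
      then show ?thesis
        using L Bmono by blast
    next
      case False
      then have "x \<in> R (L - 1)"
        using L(1) L(2)[of "L - 1"] by (auto simp: R_def)
      then have "x \<in> R ((L - 1 - n) + n)"
        using False by simp
      then show ?thesis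
        by blast
    qed
  qed
  have bound: "hausdorff_outer k (A \<inter> C) + hausdorff_outer k (A - C)
      \<le> hausdorff_outer k A + (\<Sum>m. hausdorff_outer k (R (m + n)))" for n
  proof -
    have "hausdorff_outer k (A - C) \<le> hausdorff_outer k (B n \<union> (\<Union>m. R (m + n)))"
      by (rule hausdorff_outer_mono[OF AC])
    also have "\<dots> \<le> hausdorff_outer k (B n) + hausdorff_outer k (\<Union>m. R (m + n))"
      by (rule hausdorff_outer_Un_le)
    also have "\<dots> \<le> hausdorff_outer k (B n) + (\<Sum>m. hausdorff_outer k (R (m + n)))"
      by (intro add_left_mono hausdorff_outer_countably_subadditive)
    finally have "hausdorff_outer k (A \<inter> C) + hausdorff_outer k (A - C)
      \<le> hausdorff_outer k (A \<inter> C) + (hausdorff_outer k (B n) + (\<Sum>m. hausdorff_outer k (R (m + n))))"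
      by (rule add_left_mono)
    also have "\<dots> = (hausdorff_outer k (A \<inter> C) + hausdorff_outer k (B n)) + (\<Sum>m. hausdorff_outer k (R (m + n)))"
      by (simp add: add.assoc)
    also have "hausdorff_outer k (A \<inter> C) + hausdorff_outer k (B n) \<le> hausdorff_outer k (A \<inter> C \<union> B n)"
    proof (rule hausdorff_outer_separated[of "1 / real (Suc n)"])
      fix a b assume ab: "a \<in> A \<inter> C" "b \<in> B n"
      have "infdist b C \<le> dist b a"
        using ab by (intro infdist_le) auto
      then show "1 / real (Suc n) \<le> dist a b"
        using ab by (simp add: B_def dist_commute)
    qed auto
    also have "hausdorff_outer k (A \<inter> C \<union> B n) \<le> hausdorff_outer k A"
      by (rule hausdorff_outer_mono) (auto simp: B_def)
    finally show ?thesis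
      by (simp add: add_right_mono)
  qed
  have "(\<lambda>n. hausdorff_outer k A + (\<Sum>m. hausdorff_outer k (R (m + n)))) \<longlonglongrightarrow> hausdorff_outer k A + 0"
    by (intro tendsto_add tail tendsto_const)
  then show ?thesis
    using bound by (simp add: LIMSEQ_le_const)
qed

lemma sets_hausdorff_measure [simp, measurable_cong]: "sets (hausdorff_measure k) = sets borel"
  unfolding hausdorff_measure_def by (metis sets.sigma_sets_eq sets_measure_of space_borel sets.space_closed)

lemma space_hausdorff_measure [simp]: "space (hausdorff_measure k) = UNIV"
  by (simp add: hausdorff_measure_def space_measure_of_conv)

lemma emeasure_hausdorff_measure:
  fixes A :: "'a::metric_space set"
  assumes "A \<in> sets borel"
  shows "emeasure (hausdorff_measure k) A = hausdorff_outer k A"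
proof -
  interpret P: sigma_algebra UNIV "Pow UNIV :: 'a set set"
    by (rule sigma_algebra_Pow)
  let ?L = "lambda_system UNIV (Pow UNIV) (hausdorff_outer k) :: 'a set set"
  have ms: "measure_space UNIV ?L (hausdorff_outer k)"
    by (rule P.caratheodory_lemma[OF outer_measure_space_hausdorff])
  have "{S. closed S} \<subseteq> ?L"
  proof
    fix C :: "'a set" assume "C \<in> {S. closed S}"
    then have "closed C" by simp
    have "hausdorff_outer k (A \<inter> C) + hausdorff_outer k (A - C) = hausdorff_outer k A" for A
    proof (rule antisym)
      show "hausdorff_outer k A \<le> hausdorff_outer k (A \<inter> C) + hausdorff_outer k (A - C)"
        using hausdorff_outer_Un_le[of k "A \<inter> C" "A - C"] by (simp add: Un_Diff_Int Int_Diff_Un)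
    qed (rule hausdorff_outer_closed[OF \<open>closed C\<close>])
    then show "C \<in> ?L"
      using P.lambda_system_eq[of "hausdorff_outer k"] by simp
  qed
  then have "sets borel \<subseteq> ?L"
    using ms unfolding borel_eq_closed measure_space_def
    by (simp add: sigma_algebra.sigma_sets_subset)
  then have "measure_space UNIV (sets borel) (hausdorff_outer k :: 'a set \<Rightarrow> ennreal)"
    using ms sets.sigma_algebra_axioms[of "borel :: 'a measure"]
    by (auto simp: measure_space_def positive_def countably_additive_def subset_iff)
  then show ?thesis
    using assms sets.sigma_sets_eq[of "borel :: 'a measure"]
    by (simp add: hausdorff_measure_def emeasure_measure_of_conv)
qed

section \<open>Surface area measure of a convex body\<close>

definition convex_body :: "'a::euclidean_space set \<Rightarrow> bool" where
  "convex_body K \<longleftrightarrow> compact K \<and> convex K \<and> interior K \<noteq> {}"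

definition outer_unit_normal :: "'a::euclidean_space set \<Rightarrow> 'a \<Rightarrow> 'a \<Rightarrow> bool" where
  "outer_unit_normal K x u \<longleftrightarrow> norm u = 1 \<and> (\<forall>y\<in>K. u \<bullet> (y - x) \<le> 0)"

text \<open>The domain of the outer Gauss map: boundary points with exactly one outer unit normal. The
  remaining boundary points form a null set and are left out of the pushforward.\<close>

definition regular_points :: "'a::euclidean_space set \<Rightarrow> 'a set" where
  "regular_points K = {x \<in> frontier K. \<exists>!u. outer_unit_normal K x u}"

definition gauss_map :: "'a::euclidean_space set \<Rightarrow> 'a \<Rightarrow> 'a" where
  "gauss_map K x = (THE u. outer_unit_normal K x u)"

abbreviation sphere_borel :: "'a::euclidean_space measure" where
  "sphere_borel \<equiv> restrict_space borel (sphere 0 1)"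

definition surface_area_measure :: "'a::euclidean_space set \<Rightarrow> 'a measure" where
  "surface_area_measure K =
     distr (restrict_space (hausdorff_measure (DIM('a) - 1)) (regular_points K))
       sphere_borel (gauss_map K)"

definition surface_area :: "'a::euclidean_space set \<Rightarrow> real" where
  "surface_area K = measure (surface_area_measure K) (sphere 0 1)"

lemma gauss_map_regular: "x \<in> regular_points K \<Longrightarrow> outer_unit_normal K x (gauss_map K x)"
  unfolding regular_points_def gauss_map_def by (auto intro: theI')

lemma closed_outer_unit_normal:
  "closed {p. outer_unit_normal K (fst p) (snd p)}"
proof -
  have "{p. outer_unit_normal K (fst p) (snd p)} =
      {p. norm (snd p) = 1} \<inter> (\<Inter>y\<in>K. {p. snd p \<bullet> (y - fst p) \<le> 0})"
    by (auto simp: outer_unit_normal_def)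
  also have "closed \<dots>"
    by (intro closed_Int closed_INT ballI closed_Collect_eq closed_Collect_le continuous_intros)
  finally show ?thesis .
qed

lemma exists_outer_unit_normal:
  fixes K :: "'a::euclidean_space set"
  assumes "convex_body K" "x \<in> frontier K"
  shows "\<exists>u. outer_unit_normal K x u"
proof -
  have K: "convex K" "closed K" "interior K \<noteq> {}"
    using assms(1) by (auto simp: convex_body_def compact_imp_closed)
  then have "rel_interior K = interior K"
    by (simp add: rel_interior_nonempty_interior)
  then have x: "x \<in> closure K" "x \<notin> rel_interior K"
    using assms(2) by (auto simp: frontier_def)
  obtain a where a: "a \<noteq> 0" "\<And>y. y \<in> closure K \<Longrightarrow> a \<bullet> x \<le> a \<bullet> y"
    using supporting_hyperplane_relative_frontier[OF K(1) x] by metis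
  have "outer_unit_normal K x (- (a /\<^sub>R norm a))"
    using a closure_subset[of K]
    by (auto simp: outer_unit_normal_def inner_diff_right intro!: mult_left_mono)
  then show ?thesis ..
qed

lemma regular_points_borel:
  fixes K :: "'a::euclidean_space set"
  assumes "convex_body K"
  shows "regular_points K \<in> sets borel"
proof -
  define P :: "nat \<Rightarrow> ('a \<times> 'a \<times> 'a) set" where
    "P n = frontier K \<times> (sphere 0 1 \<times> sphere 0 1) \<inter>
       ({p. outer_unit_normal K (fst p) (fst (snd p))} \<inter> {p. outer_unit_normal K (fst p) (snd (snd p))}
        \<inter> {p. 1 / real (Suc n) \<le> dist (fst (snd p)) (snd (snd p))})" for n
  have cl: "closed {p. outer_unit_normal K (f p) (g p)}"
    if "continuous_on UNIV f" "continuous_on UNIV g" for f g :: "'a \<times> 'a \<times> 'a \<Rightarrow> 'a"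
    using continuous_closed_vimage[OF closed_outer_unit_normal[of K], of "\<lambda>p. (f p, g p)"] that
    by (auto simp: vimage_def continuous_on_eq_continuous_at intro: continuous_on_Pair continuous_Pair)
  have "compact (P n)" for n
    unfolding P_def using assms
    by (intro compact_Int_closed compact_Times compact_frontier closed_Int cl closed_Collect_le
          continuous_intros) (auto simp: convex_body_def)
  then have "compact (fst ` P n)" for n
    by (intro compact_continuous_image continuous_intros)
  then have "fst ` P n \<in> sets borel" for n
    by (simp add: borel_compact)
  moreover have "regular_points K = frontier K - (\<Union>n. fst ` P n)"
  proof (intro equalityI subsetI)
    fix x assume x: "x \<in> regular_points K"
    have "(x, u, v) \<notin> P n" for u v n
    proof
      assume p: "(x, u, v) \<in> P n"
      then have "u = v"
        using x unfolding regular_points_def P_def by auto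
      then have "1 / real (Suc n) \<le> 0"
        using p by (simp add: P_def)
      then show False
        by (simp add: field_simps)
    qed
    then show "x \<in> frontier K - (\<Union>n. fst ` P n)"
      using x by (force simp: regular_points_def)
  next
    fix x assume x: "x \<in> frontier K - (\<Union>n. fst ` P n)"
    have "u = v" if "outer_unit_normal K x u" "outer_unit_normal K x v" for u v
    proof (rule ccontr)
      assume "u \<noteq> v"
      then obtain n where "1 / real (Suc n) \<le> dist u v"
        by (metis inverse_eq_divide less_imp_le nat_approx_posE zero_less_dist_iff)
      then have "(x, u, v) \<in> P n"
        using x that by (auto simp: P_def outer_unit_normal_def)
      then have "x \<in> (\<Union>n. fst ` P n)"
        by force
      then show False
        using x by blast
    qed
    then show "x \<in> regular_points K"
      using x exists_outer_unit_normal[OF assms, of x] by (auto simp: regular_points_def)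
  qed
  ultimately show ?thesis
    by (auto intro!: sets.Diff sets.countable_UN borel_closed frontier_closed)
qed

lemma gauss_map_measurable:
  fixes K :: "'a::euclidean_space set"
  shows "gauss_map K \<in> restrict_space (hausdorff_measure k) (regular_points K) \<rightarrow>\<^sub>M sphere_borel"
proof -
  let ?S = "regular_points K"
  have sph: "gauss_map K \<in> ?S \<rightarrow> sphere 0 1"
    using gauss_map_regular[of _ K] by (auto simp: outer_unit_normal_def)
  have "(\<lambda>x. (x, gauss_map K x)) ` ?S = (?S \<times> sphere 0 1) \<inter> {p. outer_unit_normal K (fst p) (snd p)}"
  proof (intro equalityI subsetI)
    fix p assume "p \<in> (?S \<times> sphere 0 1) \<inter> {p. outer_unit_normal K (fst p) (snd p)}"
    then have p: "fst p \<in> ?S" "outer_unit_normal K (fst p) (snd p)"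
      by auto
    then have "snd p = gauss_map K (fst p)"
      using gauss_map_regular[OF p(1)] unfolding regular_points_def by blast
    then have "p = (fst p, gauss_map K (fst p))"
      by (simp add: prod_eq_iff)
    then show "p \<in> (\<lambda>x. (x, gauss_map K x)) ` ?S"
      using p(1) by blast
  qed (use gauss_map_regular sph in auto)
  then have "closedin (top_of_set (?S \<times> sphere 0 1)) ((\<lambda>x. (x, gauss_map K x)) ` ?S)"
    by (simp add: closedin_closed_Int closed_outer_unit_normal)
  then have "continuous_on ?S (gauss_map K)"
    by (subst continuous_closed_graph_eq[OF _ sph]) auto
  then have "gauss_map K \<in> borel_measurable (restrict_space borel ?S)"
    by (rule borel_measurable_continuous_on_restrict)
  then have "gauss_map K \<in> borel_measurable (restrict_space (hausdorff_measure k) ?S)"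
    by (subst measurable_cong_sets[OF sets_restrict_space_cong[OF sets_hausdorff_measure] refl])
  then show ?thesis
    using sph by (intro measurable_restrict_space2) (auto simp: space_restrict_space)
qed

lemma emeasure_surface_area_measure:
  fixes K :: "'a::euclidean_space set"
  assumes "convex_body K" "A \<in> sets (sphere_borel :: 'a measure)"
  shows "emeasure (surface_area_measure K) A =
    hausdorff_outer (DIM('a) - 1) {x \<in> regular_points K. gauss_map K x \<in> A}"
proof -
  let ?H = "hausdorff_measure (DIM('a) - 1) :: 'a measure"
  let ?T = "{x \<in> regular_points K. gauss_map K x \<in> A}"
  have reg: "regular_points K \<in> sets ?H"
    using regular_points_borel[OF assms(1)] by simp
  have T: "gauss_map K -` A \<inter> space (restrict_space ?H (regular_points K)) = ?T"
    by (auto simp: space_restrict_space)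
  have "?T \<in> sets (restrict_space ?H (regular_points K))"
    using measurable_sets[OF gauss_map_measurable assms(2)] T by metis
  then have "?T \<in> sets borel"
    using reg by (simp add: sets_restrict_space_iff)
  moreover have "emeasure (surface_area_measure K) A = emeasure (restrict_space ?H (regular_points K)) ?T"
    unfolding surface_area_measure_def emeasure_distr[OF gauss_map_measurable assms(2)] T ..
  moreover have "\<dots> = emeasure ?H ?T"
    using reg by (intro emeasure_restrict_space) auto
  ultimately show ?thesis
    by (simp add: emeasure_hausdorff_measure)
qed

section \<open>The transform, spherical designs and best approximation\<close>

definition B_transform :: "(real \<Rightarrow> real) \<Rightarrow> 'a::euclidean_space set \<Rightarrow> 'a \<Rightarrow> real" where
  "B_transform \<psi> K u = 1 / 2 * (LINT v|surface_area_measure K. \<psi> (u \<bullet> v))"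

text \<open>Invariance under $SO(d)$. For $d \ge 2$ there is exactly one such measure.\<close>

definition rotation_invariant_prob :: "(real ^ 'n) measure \<Rightarrow> bool" where
  "rotation_invariant_prob \<sigma> \<longleftrightarrow>
     prob_space \<sigma> \<and> sets \<sigma> = sets sphere_borel \<and>
     (\<forall>Q :: real ^ 'n ^ 'n. rotation_matrix Q \<longrightarrow> distr \<sigma> \<sigma> (\<lambda>x. Q *v x) = \<sigma>)"

definition polynomial_functions :: "nat \<Rightarrow> (real ^ 'n \<Rightarrow> real) set" where
  "polynomial_functions t =
     {f. \<exists>c :: ('n \<Rightarrow> nat) \<Rightarrow> real.
           f = (\<lambda>x. \<Sum>\<alpha> | (\<Sum>i\<in>UNIV. \<alpha> i) \<le> t. c \<alpha> * (\<Prod>i\<in>UNIV. (x $ i) ^ \<alpha> i))}"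

lemma finite_multi_indices: "finite {\<alpha> :: 'n::finite \<Rightarrow> nat. (\<Sum>i\<in>UNIV. \<alpha> i) \<le> t}"
proof (rule finite_subset)
  have "\<alpha> i \<le> t" if "(\<Sum>i\<in>UNIV. \<alpha> i) \<le> t" for \<alpha> :: "'n \<Rightarrow> nat" and i
    using that member_le_sum[of i UNIV \<alpha>] by simp
  then show "{\<alpha>. (\<Sum>i\<in>UNIV. \<alpha> i) \<le> t} \<subseteq> (UNIV :: 'n set) \<rightarrow>\<^sub>E {..t}"
    by (auto simp: PiE_def extensional_def)
qed (simp add: finite_PiE)

definition spherical_design :: "(real ^ 'n) measure \<Rightarrow> nat \<Rightarrow> (real ^ 'n) set \<Rightarrow> bool" where
  "spherical_design \<sigma> t X \<longleftrightarrow>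
     finite X \<and> X \<subseteq> sphere 0 1 \<and>
     (\<forall>f\<in>polynomial_functions t. 1 / real (card X) * (\<Sum>x\<in>X. f x) = (LINT x|\<sigma>. f x))"

text \<open>Intended for functions that are measurable and essentially bounded on $[-1,1]$: a function
  with infinite essential supremum gets the value $0$.\<close>

definition Linfty_norm :: "(real \<Rightarrow> real) \<Rightarrow> real" where
  "Linfty_norm f = real_of_ereal (esssup (restrict_space lborel {-1..1}) (\<lambda>x. ereal \<bar>f x\<bar>))"

definition best_approx_error :: "nat \<Rightarrow> (real \<Rightarrow> real) \<Rightarrow> real" where
  "best_approx_error t \<psi> =
     (INF q\<in>{q :: real poly. degree q \<le> t}. Linfty_norm (\<lambda>x. \<psi> x - poly q x))"

end

theory Submission
  imports Defs
begin

text \<open>By Fubini, the quadrature error of \<open>B_transform \<psi> K\<close> is half the integral over \<open>v\<close>, against the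
  surface area measure, of the quadrature errors of the zonal functions \<open>u \<mapsto> \<psi> (u \<bullet> v)\<close>. The design
  integrates \<open>u \<mapsto> q (u \<bullet> v)\<close> exactly for a polynomial \<open>q\<close> of degree at most \<open>t\<close>, so each of these errors
  is at most \<open>2 \<parallel>\<psi> - q\<parallel>\<close>. Fubini, and the meaning of the total mass as a real number, require the
  surface area to be finite; this holds because the boundary of \<open>K\<close> is a 1-Lipschitz image of the
  boundary of a cube.\<close>

section \<open>Finiteness of the surface area\<close>

text \<open>The covers at scale \<open>1 / m\<close> have total weight at most
  \<open>c * m ^ k\<close> times the weight of a set of diameter \<open>D / m\<close>. The powers of
  \<open>m\<close> cancel, so the bound is the same for every \<open>\<delta>\<close>.\<close>

lemma hausdorff_outer_le_of_covers:
  fixes A :: "'a::metric_space set" and S :: "nat \<Rightarrow> 'i set" and V :: "nat \<Rightarrow> 'i \<Rightarrow> 'a set"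
  assumes S: "\<And>m. 0 < m \<Longrightarrow> finite (S m)" "\<And>m. 0 < m \<Longrightarrow> real (card (S m)) \<le> c * real m ^ k"
    and V: "\<And>m i. 0 < m \<Longrightarrow> i \<in> S m \<Longrightarrow> bounded (V m i)"
      "\<And>m i. 0 < m \<Longrightarrow> i \<in> S m \<Longrightarrow> diameter (V m i) \<le> D / real m"
      "\<And>m. 0 < m \<Longrightarrow> A \<subseteq> (\<Union>i\<in>S m. V m i)"
    and D: "0 \<le> D"
  shows "hausdorff_outer k A \<le> ennreal (c * (unit_ball_vol (real k) * (D / 2) ^ k))"
  unfolding hausdorff_outer_def
proof (rule SUP_least)
  fix \<delta> :: real assume "\<delta> \<in> {0<..}"
  then have \<delta>: "\<delta> > 0" by simp
  \<comment> \<open>The strict inequality yields both \<open>D / m \<le> \<delta>\<close> and, since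
    \<open>D\<close> is nonnegative, \<open>m > 0\<close>.\<close>
  obtain m :: nat where m: "D / \<delta> < real m"
    using reals_Archimedean2 by blast
  then have m0: "0 < m"
    using D \<delta> by (cases m) (auto simp: divide_less_0_iff not_less)
  have Dm: "D / real m \<le> \<delta>"
    using m m0 \<delta> by (simp add: field_simps)
  let ?n = "card (S m)"
  obtain h where h: "bij_betw h {0..<?n} (S m)"
    using ex_bij_betw_nat_finite[OF S(1)[OF m0]] by blast
  \<comment> \<open>The finite cover is padded to a sequence with empty sets, which have weight 0
    even for \<open>k = 0\<close>.\<close>
  define U where "U i = (if i < ?n then V m (h i) else {})" for i
  have hS: "h i \<in> S m" if "i < ?n" for i
    using h that by (auto simp: bij_betw_def)
  have "hausdorff_pre k \<delta> A \<le> (\<Sum>i. hausdorff_weight k (U i))"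
  proof (rule hausdorff_pre_le)
    show "bounded (U i)" for i
      using V(1)[OF m0 hS] by (auto simp: U_def)
    show "diameter (U i) \<le> \<delta>" for i
      using V(2)[OF m0 hS, of i] Dm \<delta> by (auto simp: U_def diameter_def[of "{}"])
    show "A \<subseteq> (\<Union>i. U i)"
    proof
      fix x assume "x \<in> A"
      then obtain j where j: "j \<in> S m" "x \<in> V m j"
        using V(3)[OF m0] by blast
      then have "j \<in> h ` {0..<?n}"
        using h by (simp add: bij_betw_def)
      then obtain i where "i < ?n" "h i = j"
        by auto
      then have "x \<in> U i"
        using j by (simp add: U_def)
      then show "x \<in> (\<Union>i. U i)" by blast
    qed
  qed
  also have "\<dots> = (\<Sum>i<?n. hausdorff_weight k (U i))"
    by (rule suminf_finite) (auto simp: U_def)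
  also have "\<dots> \<le> (\<Sum>i<?n. ennreal (unit_ball_vol (real k) * ((D / real m) / 2) ^ k))"
  proof (rule sum_mono)
    fix i assume "i \<in> {..<?n}"
    then have i: "i < ?n" by simp
    have "0 \<le> diameter (V m (h i))"
      by (rule diameter_ge_0[OF V(1)[OF m0 hS[OF i]]])
    then have "unit_ball_vol (real k) * (diameter (V m (h i)) / 2) ^ k
        \<le> unit_ball_vol (real k) * ((D / real m) / 2) ^ k"
      using V(2)[OF m0 hS[OF i]] by (intro mult_left_mono power_mono divide_right_mono) auto
    then show "hausdorff_weight k (U i) \<le> ennreal (unit_ball_vol (real k) * ((D / real m) / 2) ^ k)"
      using i by (simp add: U_def hausdorff_weight_def ennreal_leI)
  qed
  also have "\<dots> = ennreal (real ?n * (unit_ball_vol (real k) * ((D / real m) / 2) ^ k))"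
    using D by (subst sum_ennreal) auto
  also have "\<dots> \<le> ennreal (c * (unit_ball_vol (real k) * (D / 2) ^ k))"
  proof (rule ennreal_leI)
    have "real ?n * (unit_ball_vol (real k) * ((D / real m) / 2) ^ k)
        \<le> (c * real m ^ k) * (unit_ball_vol (real k) * ((D / real m) / 2) ^ k)"
      using S(2)[OF m0] D by (intro mult_right_mono) auto
    also have "\<dots> = c * (unit_ball_vol (real k) * (D / 2) ^ k)"
      using m0 by (simp add: power_divide)
    finally show "real ?n * (unit_ball_vol (real k) * ((D / real m) / 2) ^ k)
        \<le> c * (unit_ball_vol (real k) * (D / 2) ^ k)" .
  qed
  finally show "hausdorff_pre k \<delta> A \<le> ennreal (c * (unit_ball_vol (real k) * (D / 2) ^ k))" .
qed

text \<open>In an index \<open>(b, s, g)\<close> the face of the cube lies in the hyperplane \<open>x \<bullet> b = s\<close>, and \<open>g\<close> gives the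
  position of the cell in the grid that divides every edge into \<open>m\<close> parts.\<close>

definition face_cell :: "real \<Rightarrow> nat \<Rightarrow> 'a::euclidean_space \<times> real \<times> ('a \<Rightarrow> nat) \<Rightarrow> 'a set" where
  "face_cell L m = (\<lambda>(b, s, g). {x. x \<bullet> b = s \<and>
     (\<forall>i\<in>Basis - {b}. real (g i) * (2 * L / real m) \<le> x \<bullet> i + L
        \<and> x \<bullet> i + L \<le> real (Suc (g i)) * (2 * L / real m))})"

definition face_index :: "real \<Rightarrow> nat \<Rightarrow> ('a::euclidean_space \<times> real \<times> ('a \<Rightarrow> nat)) set" where
  "face_index L m = Sigma Basis (\<lambda>b. {L, -L} \<times> (Basis - {b} \<rightarrow>\<^sub>E {..<m}))"

text \<open>Since \<open>L > 0\<close>, the values \<open>L\<close> and \<open>- L\<close> are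
  distinct and there are two faces for each \<open>b\<close>. The exponent of \<open>m\<close> is
  the dimension of a face, which is the growth that \<open>hausdorff_outer_le_of_covers\<close>
  allows.\<close>

lemma card_face_index:
  assumes "L > 0"
  shows "card (face_index L m :: ('a::euclidean_space \<times> _) set)
    = 2 * DIM('a) * m ^ (DIM('a) - 1)"
  using assms by (simp add: face_index_def card_SigmaI card_cartesian_product card_PiE finite_PiE)

text \<open>Two points of a cell differ by at most one edge length in each coordinate, and the norm
  is at most the sum of the absolute coordinates. This crude factor is enough for
  finiteness.\<close>

lemma face_cell_dist:
  fixes x y :: "'a::euclidean_space"
  assumes "L > 0" "x \<in> face_cell L m p" "y \<in> face_cell L m p"
  shows "dist x y \<le> real DIM('a) * (2 * L) / real m"
proof -
  obtain b s g where p: "p = (b, s, g)" by (cases p)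
  have "\<bar>(x - y) \<bullet> i\<bar> \<le> 2 * L / real m" if "i \<in> Basis" for i
  proof (cases "i = b")
    case True
    then show ?thesis
      using assms by (simp add: p face_cell_def inner_diff_left)
  next
    case False
    define w where "w = 2 * L / real m"
    have "real (g i) * w \<le> x \<bullet> i + L" "x \<bullet> i + L \<le> real (Suc (g i)) * w"
      "real (g i) * w \<le> y \<bullet> i + L" "y \<bullet> i + L \<le> real (Suc (g i)) * w"
      using assms(2,3) that False by (auto simp: p face_cell_def w_def)
    moreover have "real (Suc (g i)) * w = real (g i) * w + w"
      by (simp add: distrib_right)
    ultimately show ?thesis
      unfolding w_def[symmetric] inner_diff_left by linarith
  qed
  then have "(\<Sum>i\<in>Basis. \<bar>(x - y) \<bullet> i\<bar>) \<le> (\<Sum>i\<in>(Basis :: 'a set). 2 * L / real m)"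
    by (rule sum_mono)
  then show ?thesis
    using norm_le_l1[of "x - y"] by (simp add: dist_norm)
qed

lemma frontier_cube_subset_face_cells:
  fixes x :: "'a::euclidean_space"
  assumes L: "L > 0" and m: "m > 0"
    and x: "\<And>i. i \<in> Basis \<Longrightarrow> \<bar>x \<bullet> i\<bar> \<le> L" and b: "b \<in> Basis" "\<bar>x \<bullet> b\<bar> = L"
  shows "\<exists>p\<in>face_index L m. x \<in> face_cell L m p"
proof -
  define w where "w = 2 * L / real m"
  have w: "w > 0" "real m * w = 2 * L"
    using L m by (auto simp: w_def)
  have "\<exists>j<m. real j * w \<le> x \<bullet> i + L \<and> x \<bullet> i + L \<le> real (Suc j) * w" if i: "i \<in> Basis" for i
  proof -
    define z where "z = x \<bullet> i + L"
    have z: "0 \<le> z" "z \<le> real m * w"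
      using x[OF i] w by (auto simp: z_def)
    show ?thesis
    \<comment> \<open>At the right end point the floor would give the index \<open>m\<close>, which
      is out of range; the last cell \<open>m - 1\<close> is closed and contains this point.\<close>
    proof (cases "z = real m * w")
      case True
      then show ?thesis
        using m w by (intro exI[of _ "m - 1"]) (auto simp: z_def[symmetric] of_nat_diff left_diff_distrib)
    next
      case False
      define j where "j = nat \<lfloor>z / w\<rfloor>"
      have "real j \<le> z / w" "z / w < real j + 1"
        using z w by (auto simp: j_def)
      then have j: "real j * w \<le> z" "z < (real j + 1) * w"
        using w by (auto simp: field_simps)
      have "real j * w < real m * w"
        using j z False by linarith
      then have "j < m"
        using w(1) by (simp only: mult_less_cancel_right_pos of_nat_less_iff)
      then show ?thesis
        using j unfolding z_def by (intro exI[of _ j]) (simp add: algebra_simps)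
    qed
  qed
  then obtain g where g: "\<And>i. i \<in> Basis \<Longrightarrow> g i < m \<and> real (g i) * w \<le> x \<bullet> i + L
      \<and> x \<bullet> i + L \<le> real (Suc (g i)) * w"
    by metis
  \<comment> \<open>The restriction makes the position extensional, as membership in the function
    space of \<open>face_index\<close> requires.\<close>
  have "(b, x \<bullet> b, restrict g (Basis - {b})) \<in> face_index L m"
    using b g by (auto simp: face_index_def)
  moreover have "x \<in> face_cell L m (b, x \<bullet> b, restrict g (Basis - {b}))"
    using g by (auto simp: face_cell_def w_def[symmetric])
  ultimately show ?thesis by blast
qed

text \<open>The nearest-point projection onto \<open>K\<close> is 1-Lipschitz and maps the boundary of any cube
  around \<open>K\<close> onto the boundary of \<open>K\<close>.\<close>

lemma frontier_convex_body_cube: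
  fixes K :: "'a::euclidean_space set"
  assumes K: "convex_body K" and L: "L > 0" "K \<subseteq> cbox (- L *\<^sub>R One) (L *\<^sub>R One)"
    and x: "x \<in> frontier K"
  obtains y b where "\<And>i. i \<in> Basis \<Longrightarrow> \<bar>y \<bullet> i\<bar> \<le> L" "b \<in> Basis" "\<bar>y \<bullet> b\<bar> = L" "closest_point K y = x"
proof -
  have cK: "convex K" "closed K"
    using K by (auto simp: convex_body_def compact_imp_closed)
  have xK: "x \<in> K"
    using x cK(2) by (simp add: frontier_def)
  obtain u where u: "norm u = 1" "\<And>z. z \<in> K \<Longrightarrow> u \<bullet> (z - x) \<le> 0"
    using exists_outer_unit_normal[OF K x] by (auto simp: outer_unit_normal_def)
  \<comment> \<open>The preimage of \<open>x\<close> is sought on the normal ray at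
    \<open>x\<close>: the ray starts in the cube and leaves it, so by connectedness it meets the
    boundary of the cube.\<close>
  let ?C = "cbox (- L *\<^sub>R One) (L *\<^sub>R One) :: 'a set"
  let ?R = "(\<lambda>s. x + s *\<^sub>R u) ` {0..}"
  have "connected ?R"
    by (intro connected_continuous_image continuous_intros convex_connected) auto
  moreover have "?R \<inter> ?C \<noteq> {}"
  proof -
    have "x \<in> ?R" by (rule image_eqI[of _ _ 0]) auto
    then show ?thesis using xK L by blast
  qed
  moreover have "?R - ?C \<noteq> {}"
  proof
    assume "?R - ?C = {}"
    then have "bounded ?R"
      using bounded_subset[OF bounded_cbox[of "- L *\<^sub>R One" "L *\<^sub>R One"]] by blast
    then obtain B where B: "\<And>y. y \<in> ?R \<Longrightarrow> norm y \<le> B"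
      unfolding bounded_iff by blast
    have "x \<in> ?R"
      by (rule image_eqI[of _ _ 0]) auto
    then have "B \<ge> 0"
      using B[of x] norm_ge_zero[of x] by linarith
    \<comment> \<open>This parameter puts the point at norm at least \<open>B + 1\<close>, beyond
      the supposed bound \<open>B\<close>.\<close>
    have "x + (B + norm x + 1) *\<^sub>R u \<in> ?R"
      using \<open>B \<ge> 0\<close> by (intro imageI) auto
    from B[OF this] have "norm (x + (B + norm x + 1) *\<^sub>R u) \<le> B" .
    moreover have "norm ((B + norm x + 1) *\<^sub>R u) = B + norm x + 1"
      using u \<open>B \<ge> 0\<close> by simp
    ultimately show False
      using norm_diff_ineq[of "(B + norm x + 1) *\<^sub>R u" x] by (simp add: add.commute)
  qed
  ultimately have "?R \<inter> frontier ?C \<noteq> {}"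
    by (rule connected_Int_frontier)
  then obtain s where s: "s \<ge> 0" "x + s *\<^sub>R u \<in> frontier ?C"
    by auto
  let ?y = "x + s *\<^sub>R u"
  have yC: "?y \<in> ?C" "?y \<notin> box (- L *\<^sub>R One) (L *\<^sub>R One)"
    using s(2) by (auto simp: frontier_cbox)
  then obtain b where b: "b \<in> Basis" "\<not> (- L < ?y \<bullet> b \<and> ?y \<bullet> b < L)"
    by (auto simp: mem_box)
  have yi: "\<bar>?y \<bullet> i\<bar> \<le> L" if "i \<in> Basis" for i
  proof -
    have "- L \<le> ?y \<bullet> i" "?y \<bullet> i \<le> L"
      using yC(1) that unfolding mem_box by auto
    then show ?thesis by linarith
  qed
  \<comment> \<open>The distance from \<open>?y\<close> to \<open>x\<close> is \<open>s\<close>. As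
    \<open>u\<close> is an outer normal, the component of \<open>?y - z\<close> along
    \<open>u\<close> is at least \<open>s\<close>, and by Cauchy-Schwarz it is at most the distance
    from \<open>?y\<close> to \<open>z\<close>.\<close>
  have "dist ?y x \<le> dist ?y z" if "z \<in> K" for z
  proof -
    have "s \<le> s - u \<bullet> (z - x)"
      using u that by simp
    also have "\<dots> = u \<bullet> (?y - z)"
      using u by (simp add: inner_simps dot_square_norm)
    also have "\<dots> \<le> norm (?y - z)"
      using norm_cauchy_schwarz[of u "?y - z"] u by simp
    finally show ?thesis
      using s u by (simp add: dist_norm)
  qed
  then have "closest_point K ?y = x"
    using closest_point_unique[OF cK xK, of ?y] by auto
  moreover have "\<bar>?y \<bullet> b\<bar> = L"
    using yi[OF b(1)] b(2) by linarith
  ultimately show thesis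
    using that yi b(1) by blast
qed

text \<open>The projected face cells cover the boundary of \<open>K\<close>, and a 1-Lipschitz map
  does not increase their diameters, so the grid count on the cube carries over to
  \<open>K\<close>.\<close>

lemma hausdorff_outer_frontier_finite:
  fixes K :: "'a::euclidean_space set"
  assumes K: "convex_body K"
  shows "hausdorff_outer (DIM('a) - 1) (frontier K) < top"
proof -
  have cK: "convex K" "closed K" "K \<noteq> {}" "bounded K"
    using K by (auto simp: convex_body_def compact_imp_closed compact_imp_bounded)
  obtain B where B: "\<And>x. x \<in> K \<Longrightarrow> norm x \<le> B"
    using cK(4) unfolding bounded_iff by blast
  define L where "L = max B 1"
  have L: "L > 0"
    by (simp add: L_def)
  have KL: "K \<subseteq> cbox (- L *\<^sub>R One) (L *\<^sub>R One)"
  proof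
    fix x assume "x \<in> K"
    then have "\<bar>x \<bullet> i\<bar> \<le> L" if "i \<in> Basis" for i
      using Basis_le_norm[OF that, of x] B[of x] by (simp add: L_def)
    then have "- L \<le> x \<bullet> i \<and> x \<bullet> i \<le> L" if "i \<in> Basis" for i
      using that abs_le_iff[of "x \<bullet> i" L] by fastforce
    then show "x \<in> cbox (- L *\<^sub>R One) (L *\<^sub>R One)"
      by (auto simp: mem_box)
  qed
  have "hausdorff_outer (DIM('a) - 1) (frontier K) \<le> ennreal (real (2 * DIM('a)) *
      (unit_ball_vol (real (DIM('a) - 1)) * ((real DIM('a) * (2 * L)) / 2) ^ (DIM('a) - 1)))"
  proof (rule hausdorff_outer_le_of_covers[where S = "face_index L"
        and V = "\<lambda>m p. closest_point K ` face_cell L m p"])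
    fix m :: nat and p :: "'a \<times> real \<times> ('a \<Rightarrow> nat)"
    assume m: "0 < m" and p: "p \<in> face_index L m"
    have d: "dist x y \<le> real DIM('a) * (2 * L) / real m"
      if xy: "x \<in> closest_point K ` face_cell L m p" "y \<in> closest_point K ` face_cell L m p" for x y
    proof -
      obtain x' y' where "x' \<in> face_cell L m p" "x = closest_point K x'"
          "y' \<in> face_cell L m p" "y = closest_point K y'"
        using xy by blast
      then show ?thesis
        using closest_point_lipschitz[OF cK(1-3), of x' y'] face_cell_dist[OF L, of x' m p y']
        by simp
    qed
    show "bounded (closest_point K ` face_cell L m p)"
      unfolding bounded_two_points using d by blast
    show "diameter (closest_point K ` face_cell L m p) \<le> real DIM('a) * (2 * L) / real m"
      using d L by (intro diameter_le) (auto simp: dist_norm)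
  next
    fix m :: nat assume m: "0 < m"
    show "finite (face_index L m :: ('a \<times> _) set)"
      by (simp add: face_index_def finite_PiE)
    show "frontier K \<subseteq> (\<Union>p\<in>face_index L m. closest_point K ` face_cell L m p)"
    proof
      fix x assume "x \<in> frontier K"
      then obtain y b where y: "\<And>i. i \<in> Basis \<Longrightarrow> \<bar>y \<bullet> i\<bar> \<le> L" "b \<in> Basis" "\<bar>y \<bullet> b\<bar> = L"
          "closest_point K y = x"
        by (rule frontier_convex_body_cube[OF K L KL]) blast
      obtain p where "p \<in> face_index L m" "y \<in> face_cell L m p"
        using frontier_cube_subset_face_cells[OF L m y(1-3)] by blast
      then show "x \<in> (\<Union>p\<in>face_index L m. closest_point K ` face_cell L m p)"
        using y(4) by blast
    qed
  qed (use L in \<open>auto simp: card_face_index\<close>)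
  then show ?thesis
    using ennreal_less_top le_less_trans by blast
qed

section \<open>The surface area measure as a finite measure on the sphere\<close>

lemma sets_surface_area_measure: "sets (surface_area_measure K) = sets sphere_borel"
  by (simp add: surface_area_measure_def)

lemma space_surface_area_measure: "space (surface_area_measure K) = sphere 0 1"
  by (simp add: surface_area_measure_def space_restrict_space)

text \<open>The total mass is the Hausdorff measure of the regular points, which lie in the
  boundary. Finiteness also makes \<open>surface_area\<close> the true mass, because
  \<open>measure\<close> sends an infinite mass to 0.\<close>

lemma finite_surface_area_measure:
  fixes K :: "'a::euclidean_space set"
  assumes "convex_body K"
  shows "finite_measure (surface_area_measure K)"
proof (rule finite_measureI)
  have "space (surface_area_measure K) \<in> sets sphere_borel"
    using sets.top[of "surface_area_measure K"] by (simp only: sets_surface_area_measure)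
  from emeasure_surface_area_measure[OF assms this]
  have "emeasure (surface_area_measure K) (space (surface_area_measure K)) \<le>
      hausdorff_outer (DIM('a) - 1) (frontier K)"
    by (auto intro!: hausdorff_outer_mono simp: regular_points_def)
  then show "emeasure (surface_area_measure K) (space (surface_area_measure K)) \<noteq> \<infinity>"
    using hausdorff_outer_frontier_finite[OF assms] by (auto simp: top_unique)
qed

section \<open>Zonal polynomials\<close>

lemma polynomial_functions_monomial:
  assumes "(\<Sum>i\<in>UNIV. \<alpha> i) \<le> t"
  shows "(\<lambda>x::real^'n. a * (\<Prod>i\<in>UNIV. (x $ i) ^ \<alpha> i)) \<in> polynomial_functions t"
  unfolding polynomial_functions_def
proof (intro CollectI exI ext)
  fix x :: "real^'n"
  have "(\<Sum>\<beta> | (\<Sum>i\<in>UNIV. \<beta> i) \<le> t. (if \<beta> = \<alpha> then a else 0) * (\<Prod>i\<in>UNIV. (x $ i) ^ \<beta> i))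
      = (\<Sum>\<beta> | (\<Sum>i\<in>UNIV. \<beta> i) \<le> t. if \<beta> = \<alpha> then a * (\<Prod>i\<in>UNIV. (x $ i) ^ \<alpha> i) else 0)"
    by (intro sum.cong) auto
  then show "a * (\<Prod>i\<in>UNIV. (x $ i) ^ \<alpha> i) =
      (\<Sum>\<beta> | (\<Sum>i\<in>UNIV. \<beta> i) \<le> t. (if \<beta> = \<alpha> then a else 0) * (\<Prod>i\<in>UNIV. (x $ i) ^ \<beta> i))"
    using assms by (simp add: finite_multi_indices)
qed

lemma polynomial_functions_const: "(\<lambda>x::real^'n. a) \<in> polynomial_functions t"
  using polynomial_functions_monomial[of "\<lambda>_. 0" t a] by simp

lemma polynomial_functions_add:
  assumes "f \<in> polynomial_functions t" "g \<in> polynomial_functions t"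
  shows "(\<lambda>x::real^'n. f x + g x) \<in> polynomial_functions t"
proof -
  obtain c d where
    "f = (\<lambda>x. \<Sum>\<alpha> | (\<Sum>i\<in>UNIV. \<alpha> i) \<le> t. c \<alpha> * (\<Prod>i\<in>UNIV. (x $ i) ^ \<alpha> i))"
    "g = (\<lambda>x. \<Sum>\<alpha> | (\<Sum>i\<in>UNIV. \<alpha> i) \<le> t. d \<alpha> * (\<Prod>i\<in>UNIV. (x $ i) ^ \<alpha> i))"
    using assms unfolding polynomial_functions_def by blast
  then show ?thesis
    unfolding polynomial_functions_def
    by (intro CollectI exI[of _ "\<lambda>\<alpha>. c \<alpha> + d \<alpha>"]) (simp add: sum.distrib distrib_right)
qed

lemma polynomial_functions_sum:
  assumes "finite A" "\<And>a. a \<in> A \<Longrightarrow> f a \<in> polynomial_functions t"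
  shows "(\<lambda>x::real^'n. \<Sum>a\<in>A. f a x) \<in> polynomial_functions t"
  using assms by induction (auto intro: polynomial_functions_const polynomial_functions_add)

text \<open>The exponent of the coordinate \<open>j\<close> grows by one in every monomial. This
  serves the degree step for zonal polynomials, where \<open>a\<close> is a coordinate of
  \<open>v\<close>.\<close>

lemma polynomial_functions_mult_coordinate:
  fixes f :: "real^'n \<Rightarrow> real"
  assumes "f \<in> polynomial_functions t"
  shows "(\<lambda>x. a * x $ j * f x) \<in> polynomial_functions (Suc t)"
proof -
  obtain c where c: "f = (\<lambda>x. \<Sum>\<alpha> | (\<Sum>i\<in>UNIV. \<alpha> i) \<le> t. c \<alpha> * (\<Prod>i\<in>UNIV. (x $ i) ^ \<alpha> i))"
    using assms unfolding polynomial_functions_def by blast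
  have "(\<lambda>x. a * x $ j * (c \<alpha> * (\<Prod>i\<in>UNIV. (x $ i) ^ \<alpha> i))) \<in> polynomial_functions (Suc t)"
    if "(\<Sum>i\<in>UNIV. \<alpha> i) \<le> t" for \<alpha>
  proof -
    let ?\<beta> = "\<lambda>i. \<alpha> i + (if i = j then 1 else 0)"
    have "(\<Sum>i\<in>UNIV. ?\<beta> i) \<le> Suc t"
      using that by (simp add: sum.distrib)
    then have "(\<lambda>x. a * c \<alpha> * (\<Prod>i\<in>UNIV. (x $ i) ^ ?\<beta> i)) \<in> polynomial_functions (Suc t)"
      by (rule polynomial_functions_monomial)
    moreover have "(\<Prod>i\<in>UNIV. (x $ i) ^ ?\<beta> i) = x $ j * (\<Prod>i\<in>UNIV. (x $ i) ^ \<alpha> i)" for x :: "real^'n"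
    proof -
      have "(\<Prod>i\<in>UNIV. (x $ i) ^ ?\<beta> i) = (\<Prod>i\<in>UNIV. (x $ i) ^ \<alpha> i * (if i = j then x $ j else 1))"
        by (intro prod.cong) auto
      then show ?thesis
        by (simp add: prod.distrib)
    qed
    ultimately show ?thesis
      by (simp add: mult_ac)
  qed
  then show ?thesis
    unfolding c sum_distrib_left by (intro polynomial_functions_sum finite_multi_indices) auto
qed

text \<open>Horner's scheme: for \<open>q = pCons a p\<close> the value at
  \<open>x \<bullet> v\<close> is \<open>a\<close> plus the sum over \<open>j\<close> of
  \<open>v $ j * x $ j * poly p (x \<bullet> v)\<close>, where \<open>p\<close> has smaller degree
  or is zero.\<close>

lemma polynomial_functions_zonal:
  fixes v :: "real^'n"
  assumes "degree q \<le> t"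
  shows "(\<lambda>x. poly q (x \<bullet> v)) \<in> polynomial_functions t"
  using assms
proof (induction t arbitrary: q)
  case 0
  then obtain a where "q = [:a:]"
    using degree_eq_zeroE by blast
  then show ?case
    by (simp add: polynomial_functions_const)
next
  case (Suc t)
  obtain a p where q: "q = pCons a p"
    using pCons_cases by blast
  then have "degree p \<le> t"
    using Suc.prems by (auto simp: degree_pCons_eq_if split: if_splits)
  then have "(\<lambda>x. \<Sum>j\<in>UNIV. v $ j * x $ j * poly p (x \<bullet> v)) \<in> polynomial_functions (Suc t)"
    by (intro polynomial_functions_sum polynomial_functions_mult_coordinate Suc.IH) auto
  then have "(\<lambda>x. a + (\<Sum>j\<in>UNIV. v $ j * x $ j * poly p (x \<bullet> v))) \<in> polynomial_functions (Suc t)"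
    by (intro polynomial_functions_add polynomial_functions_const)
  then show ?case
    by (simp add: q inner_vec_def sum_distrib_right mult_ac)
qed

section \<open>The error bound\<close>

lemma continuous_on_Icc_bounded:
  fixes f :: "real \<Rightarrow> real"
  assumes "continuous_on {a..b} f"
  shows "\<exists>B. \<forall>s\<in>{a..b}. \<bar>f s\<bar> \<le> B"
  using compact_imp_bounded[OF compact_continuous_image[OF assms compact_Icc]]
  unfolding bounded_iff by auto

text \<open>The essential supremum bounds \<open>f\<close> only almost everywhere, but by continuity
  the set where the bound holds is closed. Being of full measure, it contains the open interval and
  hence its closure.\<close>

lemma le_Linfty_norm:
  assumes f: "continuous_on {-1..1} f" and x: "x \<in> {-1..1}"
  shows "\<bar>f x\<bar> \<le> Linfty_norm f"
proof -
  let ?M = "restrict_space lborel {-1..1::real}"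
  define E where "E = esssup ?M (\<lambda>x. ereal \<bar>f x\<bar>)"
  have "f \<in> borel_measurable (restrict_space borel {-1..1})"
    by (rule borel_measurable_continuous_on_restrict[OF f])
  then have "f \<in> borel_measurable ?M"
    by (subst measurable_cong_sets[OF sets_restrict_space_cong[OF sets_lborel] refl])
  then have meas: "(\<lambda>x. ereal \<bar>f x\<bar>) \<in> borel_measurable ?M"
    by measurable
  obtain B where B: "\<And>x. x \<in> {-1..1} \<Longrightarrow> \<bar>f x\<bar> \<le> B"
    using continuous_on_Icc_bounded[OF f] by blast
  \<comment> \<open>This excludes an infinite \<open>E\<close>, which \<open>real_of_ereal\<close>
    would turn into 0.\<close>
  have "E \<le> ereal B"
    unfolding E_def by (rule esssup_I[OF meas]) (auto intro!: AE_I2 B simp: space_restrict_space)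
  let ?C = "{x \<in> {-1..1}. ereal \<bar>f x\<bar> \<le> E}"
  have "closed ?C"
    using continuous_closed_preimage[OF continuous_on_ereal[OF continuous_on_rabs[OF f]]
        closed_atLeastAtMost closed_atMost[of E]]
    by (simp add: vimage_def Int_def)
  \<comment> \<open>The open interval and the completed measure are the setting of
    \<open>mem_closed_if_AE_lebesgue_open\<close>; the end points return through the
    closure.\<close>
  moreover have "AE x \<in> {-1<..<1} in lebesgue. x \<in> ?C"
  proof (rule AE_completion)
    have "AE x in ?M. ereal \<bar>f x\<bar> \<le> E"
      unfolding E_def by (rule esssup_AE)
    then have "AE x in lborel. x \<in> {-1..1} \<longrightarrow> ereal \<bar>f x\<bar> \<le> E"
      by (subst (asm) AE_restrict_space_iff) auto
    then show "AE x \<in> {-1<..<1} in lborel. x \<in> ?C"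
      by eventually_elim auto
  qed
  ultimately have "{-1<..<1} \<subseteq> ?C"
    by (intro subsetI mem_closed_if_AE_lebesgue_open[of "{-1<..<1}" ?C]) auto
  then have "closure {-1<..<1} \<subseteq> ?C"
    using \<open>closed ?C\<close> by (rule closure_minimal)
  then have "ereal \<bar>f x\<bar> \<le> E"
    using x by auto
  then show ?thesis
    using \<open>E \<le> ereal B\<close> unfolding Linfty_norm_def E_def[symmetric] by (cases E) auto
qed

text \<open>A bounded measurable function is integrable for a finite measure. The measure
  \<open>M\<close> is general so that both \<open>\<sigma>\<close> and the surface area measure can
  take its place.\<close>

lemma integrable_zonal:
  fixes M :: "'a::euclidean_space measure" and v :: 'a and h :: "real \<Rightarrow> real"
  assumes "finite_measure M" "sets M = sets sphere_borel" "v \<in> sphere 0 1" "continuous_on UNIV h"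
  shows "integrable M (\<lambda>u. h (u \<bullet> v))"
proof -
  interpret finite_measure M by fact
  have "space M = sphere 0 1"
    using sets_eq_imp_space_eq[OF assms(2)] by (simp add: space_restrict_space)
  moreover obtain B where "\<And>s. s \<in> {-1..1} \<Longrightarrow> \<bar>h s\<bar> \<le> B"
    using continuous_on_Icc_bounded[OF continuous_on_subset[OF assms(4) subset_UNIV]] by blast
  moreover have "u \<bullet> v \<in> {-1..1}" if "u \<in> sphere 0 1" for u
    using Cauchy_Schwarz_ineq2[of u v] that assms(3) by (simp add: abs_le_iff)
  moreover have "(\<lambda>u. h (u \<bullet> v)) \<in> borel_measurable M"
    unfolding measurable_cong_sets[OF assms(2) refl]
    by (intro measurable_restrict_space1 borel_measurable_continuous_onI
        continuous_on_compose2[OF assms(4)] continuous_intros) auto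
  ultimately show ?thesis
    by (intro integrable_const_bound[where B = B] AE_I2) auto
qed

text \<open>Since the design is exact for the zonal polynomial of \<open>q\<close>, the error for
  \<open>h\<close> equals the error for \<open>h - q\<close>. The average over \<open>X\<close> and
  the integral of this difference each contribute at most \<open>e\<close>.\<close>

lemma zonal_quadrature_error:
  fixes \<sigma> :: "(real ^ 'n) measure" and X :: "(real ^ 'n) set"
  assumes \<sigma>: "prob_space \<sigma>" "sets \<sigma> = sets sphere_borel"
    and X: "spherical_design \<sigma> t X"
    and q: "degree q \<le> t" and h: "continuous_on UNIV h"
    and e: "\<And>s. s \<in> {-1..1} \<Longrightarrow> \<bar>h s - poly q s\<bar> \<le> e"
    and v: "v \<in> sphere 0 1"
  shows "\<bar>1 / real (card X) * (\<Sum>x\<in>X. h (x \<bullet> v)) - (LINT u|\<sigma>. h (u \<bullet> v))\<bar> \<le> 2 * e"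
proof -
  interpret prob_space \<sigma> by fact
  have sp: "space \<sigma> = sphere 0 1"
    using sets_eq_imp_space_eq[OF \<sigma>(2)] by (simp add: space_restrict_space)
  have inner: "u \<bullet> v \<in> {-1..1}" if "u \<in> sphere 0 1" for u
    using Cauchy_Schwarz_ineq2[of u v] that v by (simp add: abs_le_iff)
  have X': "finite X" "X \<subseteq> sphere 0 1"
    and design: "1 / real (card X) * (\<Sum>x\<in>X. poly q (x \<bullet> v)) = (LINT u|\<sigma>. poly q (u \<bullet> v))"
    using X polynomial_functions_zonal[OF q, of v] by (auto simp: spherical_design_def)
  define g where "g s = h s - poly q s" for s
  \<comment> \<open>This settles the case \<open>card X = 0\<close> below, where division by zero
    makes the average 0.\<close>
  have "0 \<le> e"
    using e[of 0] by auto
  have int: "integrable \<sigma> (\<lambda>u. h (u \<bullet> v))" "integrable \<sigma> (\<lambda>u. poly q (u \<bullet> v))"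
      "integrable \<sigma> (\<lambda>u. g (u \<bullet> v))"
    unfolding g_def
    by (intro integrable_zonal[OF finite_measure_axioms \<sigma>(2) v] continuous_intros h)+
  have "\<bar>\<Sum>x\<in>X. g (x \<bullet> v)\<bar> \<le> (\<Sum>x\<in>X. e)"
    using X'(2) inner e by (intro order_trans[OF sum_abs] sum_mono) (auto simp: g_def)
  then have 1: "\<bar>1 / real (card X) * (\<Sum>x\<in>X. g (x \<bullet> v))\<bar> \<le> e"
    using \<open>0 \<le> e\<close> by (cases "card X = 0") (auto simp: abs_mult field_simps)
  have "\<bar>LINT u|\<sigma>. g (u \<bullet> v)\<bar> \<le> (LINT u|\<sigma>. \<bar>g (u \<bullet> v)\<bar>)"
    by (rule integral_abs_bound)
  also have "\<dots> \<le> (LINT u|\<sigma>. e)"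
    using int inner e by (intro integral_mono) (auto simp: g_def sp)
  finally have 2: "\<bar>LINT u|\<sigma>. g (u \<bullet> v)\<bar> \<le> e"
    by (simp add: prob_space)
  have "(LINT u|\<sigma>. g (u \<bullet> v)) = (LINT u|\<sigma>. h (u \<bullet> v)) - (LINT u|\<sigma>. poly q (u \<bullet> v))"
    unfolding g_def using int by (intro Bochner_Integration.integral_diff)
  moreover have "1 / real (card X) * (\<Sum>x\<in>X. g (x \<bullet> v)) =
      1 / real (card X) * (\<Sum>x\<in>X. h (x \<bullet> v)) - 1 / real (card X) * (\<Sum>x\<in>X. poly q (x \<bullet> v))"
    unfolding g_def by (simp add: sum_subtractf right_diff_distrib)
  ultimately show ?thesis
    using 1 2 design by linarith
qed

theorem theorem6p1:
  fixes \<sigma> :: "(real ^ 'n) measure" and X :: "(real ^ 'n) set" and t N :: nat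
    and \<psi> :: "real \<Rightarrow> real" and K :: "(real ^ 'n) set"
  assumes "CARD('n) \<ge> 2"
    and "rotation_invariant_prob \<sigma>"
    and "spherical_design \<sigma> t X" and "card X = N"
    and "continuous_on {-1..1} \<psi>" and "\<And>s. s \<in> {-1..1} \<Longrightarrow> \<psi> (- s) = \<psi> s"
    and "convex_body K"
  shows "\<bar>1 / real N * (\<Sum>x\<in>X. B_transform \<psi> K x) - (LINT u|\<sigma>. B_transform \<psi> K u)\<bar>
           \<le> best_approx_error t \<psi> * surface_area K"
proof -
  let ?S = "surface_area_measure K"
  have \<sigma>: "prob_space \<sigma>" "sets \<sigma> = sets sphere_borel"
    using assms(2) by (auto simp: rotation_invariant_prob_def)
  interpret \<sigma>: prob_space \<sigma> by fact
  interpret S: finite_measure ?S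
    by (rule finite_surface_area_measure[OF assms(7)])
  interpret P: pair_sigma_finite \<sigma> ?S ..
  have sp: "space \<sigma> = sphere 0 1"
    using sets_eq_imp_space_eq[OF \<sigma>(2)] by (simp add: space_restrict_space)
  have X: "finite X" "X \<subseteq> sphere 0 1"
    using assms(3) by (auto simp: spherical_design_def)
  \<comment> \<open>Clamping the argument extends \<open>\<psi>\<close>, whose values outside the
    interval are arbitrary, to a continuous function on the real line. Inner products of unit
    vectors do not leave the interval, so the transform is unchanged on the sphere.\<close>
  define h where "h s = \<psi> (max (-1) (min 1 s))" for s
  have h: "continuous_on UNIV h"
    unfolding h_def by (intro continuous_on_compose2[OF assms(5)] continuous_intros) auto
  have hpsi: "h s = \<psi> s" if "s \<in> {-1..1}" for s
    using that by (simp add: h_def)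
  have inner: "u \<bullet> v \<in> {-1..1}" if "u \<in> sphere 0 1" "v \<in> sphere 0 1" for u v :: "real^'n"
    using Cauchy_Schwarz_ineq2[of u v] that by (simp add: abs_le_iff)
  have B: "B_transform \<psi> K u = 1 / 2 * (LINT v|?S. h (u \<bullet> v))" if "u \<in> sphere 0 1" for u
    unfolding B_transform_def using that inner
    by (intro arg_cong[where f = "\<lambda>z. 1 / 2 * z"] Bochner_Integration.integral_cong refl)
       (simp add: space_surface_area_measure hpsi)
  \<comment> \<open>\<open>D v\<close> is the quadrature error of the zonal function with axis
    \<open>v\<close>; the error to be bounded is half its integral.\<close>
  define D where "D v = 1 / real N * (\<Sum>x\<in>X. h (x \<bullet> v)) - (LINT u|\<sigma>. h (u \<bullet> v))" for v
  have intS: "integrable ?S (\<lambda>v. h (u \<bullet> v))" if "u \<in> sphere 0 1" for u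
    using integrable_zonal[OF S.finite_measure_axioms sets_surface_area_measure that h]
    by (simp add: inner_commute)
  have intP: "integrable (\<sigma> \<Otimes>\<^sub>M ?S) (\<lambda>(u, v). h (u \<bullet> v))"
  proof -
    obtain C where C: "\<And>s. s \<in> {-1..1} \<Longrightarrow> \<bar>h s\<bar> \<le> C"
      using continuous_on_Icc_bounded[OF continuous_on_subset[OF h subset_UNIV]] by blast
    have [measurable]: "h \<in> borel_measurable borel"
      by (rule borel_measurable_continuous_onI[OF h])
    \<comment> \<open>Both measures carry the trace of the Borel sets on the sphere; measurability
      of the inclusion lets the inner product be treated in the whole space.\<close>
    have [measurable]: "(\<lambda>u. u) \<in> borel_measurable \<sigma>" "(\<lambda>u. u) \<in> borel_measurable ?S"
      unfolding measurable_cong_sets[OF \<sigma>(2) refl]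
        measurable_cong_sets[OF sets_surface_area_measure refl]
      by (auto intro: measurable_restrict_space1)
    have "finite_measure (\<sigma> \<Otimes>\<^sub>M ?S)"
      by (intro finite_measure_pair_measure \<sigma>.finite_measure_axioms S.finite_measure_axioms)
    moreover have "(\<lambda>(u, v). h (u \<bullet> v)) \<in> borel_measurable (\<sigma> \<Otimes>\<^sub>M ?S)"
      by measurable
    moreover have "\<bar>h (u \<bullet> v)\<bar> \<le> C" if "(u, v) \<in> space (\<sigma> \<Otimes>\<^sub>M ?S)" for u v
      using that C inner by (simp add: space_pair_measure sp space_surface_area_measure)
    ultimately show ?thesis
      by (intro finite_measure.integrable_const_bound[where B = C] AE_I2) auto
  qed
  have intD: "integrable ?S (\<lambda>v. LINT u|\<sigma>. h (u \<bullet> v))"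
    using P.integrable_snd[OF intP] .
  have "(LINT u|\<sigma>. B_transform \<psi> K u) = (LINT u|\<sigma>. 1 / 2 * (LINT v|?S. h (u \<bullet> v)))"
    by (intro Bochner_Integration.integral_cong refl B) (simp add: sp)
  also have "\<dots> = 1 / 2 * (LINT v|?S. LINT u|\<sigma>. h (u \<bullet> v))"
    using P.Fubini_integral[OF intP] by simp
  finally have F: "(LINT u|\<sigma>. B_transform \<psi> K u) = 1 / 2 * (LINT v|?S. LINT u|\<sigma>. h (u \<bullet> v))" .
  have intX: "integrable ?S (\<lambda>v. h (x \<bullet> v))" if "x \<in> X" for x
    using intS X that by blast
  have "(\<Sum>x\<in>X. B_transform \<psi> K x) = (\<Sum>x\<in>X. 1 / 2 * (LINT v|?S. h (x \<bullet> v)))"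
    using X by (intro sum.cong refl B) auto
  also have "\<dots> = 1 / 2 * (LINT v|?S. (\<Sum>x\<in>X. h (x \<bullet> v)))"
    by (simp add: Bochner_Integration.integral_sum[OF intX] sum_distrib_left)
  finally have Q: "(\<Sum>x\<in>X. B_transform \<psi> K x) = 1 / 2 * (LINT v|?S. (\<Sum>x\<in>X. h (x \<bullet> v)))" .
  have intQ: "integrable ?S (\<lambda>v. 1 / real N * (\<Sum>x\<in>X. h (x \<bullet> v)))"
    by (intro integrable_mult_right Bochner_Integration.integrable_sum intX)
  have "(LINT v|?S. D v) = 1 / real N * (LINT v|?S. (\<Sum>x\<in>X. h (x \<bullet> v)))
      - (LINT v|?S. LINT u|\<sigma>. h (u \<bullet> v))"
    unfolding D_def Bochner_Integration.integral_diff[OF intQ intD] integral_mult_right_zero ..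
  then have LHS: "1 / real N * (\<Sum>x\<in>X. B_transform \<psi> K x) - (LINT u|\<sigma>. B_transform \<psi> K u)
      = 1 / 2 * (LINT v|?S. D v)"
    unfolding F Q by (simp only: right_diff_distrib mult.left_commute)
  \<comment> \<open>For each single \<open>q\<close>, the factor 2 of
    \<open>zonal_quadrature_error\<close> cancels against the 1/2 of the transform.\<close>
  have bound: "\<bar>1 / 2 * (LINT v|?S. D v)\<bar> \<le> Linfty_norm (\<lambda>x. \<psi> x - poly q x) * surface_area K"
    if q: "degree q \<le> t" for q
  proof -
    let ?e = "Linfty_norm (\<lambda>x. \<psi> x - poly q x)"
    have e: "\<bar>h s - poly q s\<bar> \<le> ?e" if "s \<in> {-1..1}" for s
      unfolding hpsi[OF that] by (rule le_Linfty_norm[OF _ that]) (intro continuous_intros assms(5))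
    have "\<bar>LINT v|?S. D v\<bar> \<le> (LINT v|?S. \<bar>D v\<bar>)"
      by (rule integral_abs_bound)
    also have "\<dots> \<le> (LINT v|?S. 2 * ?e)"
    proof (rule integral_mono)
      show "integrable ?S (\<lambda>v. \<bar>D v\<bar>)"
        unfolding D_def by (intro integrable_abs Bochner_Integration.integrable_diff intQ intD)
      show "\<bar>D v\<bar> \<le> 2 * ?e" if "v \<in> space ?S" for v
        using zonal_quadrature_error[OF \<sigma> assms(3) q h e, of v] that
        unfolding D_def assms(4) by (simp add: space_surface_area_measure)
    qed simp
    also have "\<dots> = 2 * (?e * surface_area K)"
      by (simp add: surface_area_def space_surface_area_measure)
    finally show ?thesis by (simp add: abs_mult)
  qed
  have "0 \<le> surface_area K"
    by (simp add: surface_area_def)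
  \<comment> \<open>Passing to the infimum over \<open>q\<close> requires division by the surface
    area. If that is 0, the bound for \<open>q = 0\<close> already makes the left side
    vanish.\<close>
  then consider "surface_area K = 0" | "surface_area K > 0"
    by linarith
  then show ?thesis
  proof cases
    case 1
    then show ?thesis
      using bound[of 0] unfolding LHS by simp
  next
    case 2
    have "\<bar>1 / 2 * (LINT v|?S. D v)\<bar> / surface_area K \<le> best_approx_error t \<psi>"
      unfolding best_approx_error_def
    proof (rule cINF_greatest)
      show "{q :: real poly. degree q \<le> t} \<noteq> {}"
        by (auto intro: exI[of _ 0])
    next
      fix q :: "real poly" assume "q \<in> {q. degree q \<le> t}"
      then show "\<bar>1 / 2 * (LINT v|?S. D v)\<bar> / surface_area K \<le> Linfty_norm (\<lambda>x. \<psi> x - poly q x)"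
        using bound[of q] 2 by (simp only: pos_divide_le_eq mem_Collect_eq)
    qed
    then show ?thesis
      unfolding LHS using 2 by (simp add: pos_divide_le_eq)
  qed
qed

end
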